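(* Let $n\ge 3$ and $e\le n/2$ be positive integers. Then for at least one abelian group $G$ of order $2^n$ and exponent $2^e$ there exists a $(G,3,0)$ contracted difference matrix.
   Context: All groups are finite, and abelian groups are written additively. Difference matrix: for a non-trivial group $G$, a $(G,m,\lambda)$ difference matrix is an $m\times\lambda|G|$ matrix $(a_{ij})$ with entries in $G$ such that, for all distinct rows $i$ and $\ell$, the multiset of differences $\{a_{ij}-a_{\ell j} : 0\le j\le \lambda|G|-1\}$ contains each element of $G$ exactly $\lambda$ times. $p$-expansion: let $p$ be prime and let $M$ be a $k\times\ell$ matrix over an abelian $p$-group $G$. The $p$-expansion $f_p(M)$ is the $p^k\times p^\ell$ matrix over $G$ whose rows are indexed by $\mathbf{r}\in\mathbb{Z}_p^k$ and whose columns are indexed by $\mathbf{c}\in\mathbb{Z}_p^\ell$, with $(\mathbf{r},\mathbf{c})$ entry $\mathbf{r}M\mathbf{c}^{\intercal}=\sum_{i,j} r_i c_j M_{ij}$, where $\mathbf r,\mathbf c$ are row vectors whose entries are taken as the integer representatives in $\{0,1,\dots,p-1\}$, and integers act on $G$ in the usual way. Contracted difference matrix: let $p$ be prime and let $G$ be an abelian group of order $p^n$. A $k\times(n+s)$ matrix $M$ over $G$ is a $(G,k,s)$ contracted difference matrix if the $p^k\times p^{n+s}$ matrix $f_p(M)$ is a $(G,p^k,p^s)$ difference matrix. *)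

theory Defs
  imports Complex_Main "HOL-Computational_Algebra.Primes" "HOL-Algebra.Coset" "HOL-Algebra.FiniteProduct"
    "HOL-Library.Multiset" "HOL-Library.FuncSet" "Jordan_Normal_Form.Matrix"
begin

text \<open>
  HOL-Algebra writes groups multiplicatively: the sum of \<open>x\<close> and \<open>y\<close> is \<open>x \<otimes> y\<close>, the difference
  is \<open>x \<otimes> inv y\<close>, and the integer multiple \<open>m x\<close> is \<open>x [^] m\<close>.
\<close>

definition group_exponent :: "('a, 'b) monoid_scheme \<Rightarrow> nat" where
  "group_exponent G = (LEAST m. 0 < m \<and> (\<forall>x\<in>carrier G. x [^]\<^bsub>G\<^esub> m = \<one>\<^bsub>G\<^esub>))"

definition difference_matrix ::
    "('a, 'b) monoid_scheme \<Rightarrow> nat \<Rightarrow> nat \<Rightarrow> 'a mat \<Rightarrow> bool" where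
  "difference_matrix G m lam A \<longleftrightarrow>
     group G \<and> finite (carrier G) \<and> carrier G \<noteq> {\<one>\<^bsub>G\<^esub>} \<and>
     A \<in> carrier_mat m (lam * order G) \<and> elements_mat A \<subseteq> carrier G \<and>
     (\<forall>i<m. \<forall>l<m. i \<noteq> l \<longrightarrow>
        (\<forall>g\<in>carrier G.
           count {# A $$ (i, j) \<otimes>\<^bsub>G\<^esub> inv\<^bsub>G\<^esub> (A $$ (l, j)). j \<in># mset_set {0..<lam * order G} #} g
             = lam))"

text \<open>
  Vectors in \<open>\<int>\<^sub>p\<^sup>k\<close>, with entries represented by \<open>0, \<dots>, p - 1\<close>, are enumerated by
  the numbers below \<open>p ^ k\<close> through their base \<open>p\<close> digits, least significant digit first
  (see \<open>bij_betw_digits\<close>).  Being a difference matrix does not depend on the order in which rows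
  and columns are listed.
\<close>

definition digit :: "nat \<Rightarrow> nat \<Rightarrow> nat \<Rightarrow> nat" where
  "digit p x i = (x div p ^ i) mod p"

lemma digits_eqD:
  assumes "x < p ^ k" "y < p ^ k" "\<And>i. i < k \<Longrightarrow> digit p x i = digit p y i"
  shows "x = y"
  using assms
proof (induction k arbitrary: x y)
  case 0
  then show ?case by simp
next
  case (Suc k)
  have "x div p = y div p"
  proof (rule Suc.IH)
    show "x div p < p ^ k" "y div p < p ^ k"
      using Suc.prems(1,2) by (simp_all add: less_mult_imp_div_less mult.commute)
    show "digit p (x div p) i = digit p (y div p) i" if "i < k" for i
      using Suc.prems(3)[of "Suc i"] that by (simp add: digit_def div_mult2_eq)
  qed
  moreover have "x mod p = y mod p"
    using Suc.prems(3)[of 0] by (simp add: digit_def)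
  ultimately show ?case by (metis div_mult_mod_eq)
qed

lemma bij_betw_digits:
  assumes "0 < p"
  shows "bij_betw (\<lambda>x. \<lambda>i\<in>{..<k}. digit p x i) {..<p ^ k} ({..<k} \<rightarrow>\<^sub>E {..<p})"
proof -
  let ?f = "\<lambda>x. \<lambda>i\<in>{..<k}. digit p x i"
  have inj: "inj_on ?f {..<p ^ k}"
  proof (rule inj_onI)
    fix x y assume "x \<in> {..<p ^ k}" "y \<in> {..<p ^ k}" and eq: "?f x = ?f y"
    moreover have "digit p x i = digit p y i" if "i < k" for i
      using fun_cong[OF eq, of i] that by simp
    ultimately show "x = y" using digits_eqD[of x p k y] by simp
  qed
  have sub: "?f ` {..<p ^ k} \<subseteq> {..<k} \<rightarrow>\<^sub>E {..<p}"
    using assms by (auto simp: digit_def split: if_splits)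
  have "card (?f ` {..<p ^ k}) = card ({..<k} \<rightarrow>\<^sub>E {..<p})"
    by (simp add: card_image[OF inj] card_PiE)
  with sub have "?f ` {..<p ^ k} = {..<k} \<rightarrow>\<^sub>E {..<p}"
    by (intro card_subset_eq) (auto intro: finite_PiE)
  with inj show ?thesis by (simp add: bij_betw_def)
qed

definition p_expansion :: "nat \<Rightarrow> ('a, 'b) monoid_scheme \<Rightarrow> 'a mat \<Rightarrow> 'a mat" where
  "p_expansion p G M =
     mat (p ^ dim_row M) (p ^ dim_col M)
       (\<lambda>(r, c). finprod G (\<lambda>(i, j). (M $$ (i, j)) [^]\<^bsub>G\<^esub> (digit p r i * digit p c j))
                   ({..<dim_row M} \<times> {..<dim_col M}))"

definition contracted_difference_matrix ::
    "nat \<Rightarrow> ('a, 'b) monoid_scheme \<Rightarrow> nat \<Rightarrow> nat \<Rightarrow> 'a mat \<Rightarrow> bool" where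
  "contracted_difference_matrix p G k s M \<longleftrightarrow>
     prime p \<and> comm_group G \<and>
     (\<exists>n. order G = p ^ n \<and> M \<in> carrier_mat k (n + s) \<and> elements_mat M \<subseteq> carrier G \<and>
          difference_matrix G (p ^ k) (p ^ s) (p_expansion p G M))"

end

theory Submission
  imports Defs "HOL-Algebra.Elementary_Groups" "HOL-Algebra.Weak_Morphisms" "HOL-Library.Countable"
begin

text \<open>
  Write \<open>G\<close> additively. Let \<open>M\<close> be a \<open>k \<times> n\<close> matrix over \<open>G\<close>, where \<open>G\<close> has order \<open>2 ^ n\<close>. Two different rows
  \<open>r, s \<in> {0, 1}\<^sup>k\<close> of the \<open>2\<close>-expansion differ by the non-zero vector \<open>a = r - s \<in> {-1, 0, 1}\<^sup>k\<close>, and the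
  difference of their entries in column \<open>c \<in> {0, 1}\<^sup>n\<close> is the sum of those entries of the row vector
  \<open>a M\<close> that \<open>c\<close> selects. So \<open>M\<close> is a \<open>(G, k, 0)\<close> contracted difference matrix as soon as the \<open>2 ^ n\<close>
  subset sums of \<open>a M\<close> are distinct for each such \<open>a\<close>. The difference of two subset sums is
  a combination with coefficients in \<open>{-1, 0, 1}\<close>, so it suffices that no non-trivial combination of this kind
  vanishes on \<open>a M\<close>: the row vector \<open>a M\<close> is dissociated
  (\<open>contracted_columns_imp_contracted_difference_matrix\<close>).

  Dissociated sequences behave well under extensions. Let \<open>H\<close> be a subgroup of \<open>G\<close> with quotient \<open>Q\<close>. In a
  vanishing signed combination of lifts of a dissociated sequence of \<open>Q\<close> and of the elements of a
  dissociated sequence of \<open>H\<close>, passing to \<open>Q\<close> kills the coefficients of the lifts, and then the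
  coefficients of the elements of \<open>H\<close> vanish too. Consequently, putting lifts of the columns of a matrix for
  \<open>Q\<close> next to the columns of a matrix for \<open>H\<close> gives a matrix for \<open>G\<close> (\<open>contracted_columns_extension\<close>).

  The groups used are \<open>\<int>/2\<^sup>e \<times> (\<int>/2)\<^sup>l\<close>, of order \<open>2 ^ (e + l)\<close> and, for \<open>e \<ge> 1\<close>, of exponent \<open>2 ^ e\<close>. Such a group with
  parameters \<open>(e + f, l + m)\<close> is an extension of the one with parameters \<open>(e, l)\<close> by the one with parameters
  \<open>(f, m)\<close>, so the pairs \<open>(e, l)\<close> that admit three rows are closed under addition. Explicit matrices for
  \<open>(0, 3)\<close>, \<open>(1, 2)\<close>, \<open>(1, 3)\<close>, \<open>(1, 4)\<close>, \<open>(2, 2)\<close>, \<open>(2, 3)\<close> and \<open>(3, 3)\<close> generate all pairs with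
  \<open>1 \<le> e \<le> l\<close> and \<open>e + l \<ge> 3\<close>. The theorem is the case \<open>l = n - e\<close>.
\<close>

section \<open>Dissociated sequences and their subset sums\<close>

primrec signed_sums :: "('a, 'b) monoid_scheme \<Rightarrow> 'a list \<Rightarrow> 'a set" where
  "signed_sums G [] = {\<one>\<^bsub>G\<^esub>}"
| "signed_sums G (g # gs) =
     (\<Union>s\<in>signed_sums G gs. {s, g \<otimes>\<^bsub>G\<^esub> s, inv\<^bsub>G\<^esub> g \<otimes>\<^bsub>G\<^esub> s})"

text \<open>
  No non-trivial combination with coefficients in \<open>{-1, 0, 1}\<close> vanishes: otherwise its first non-zero
  coefficient, which may be taken to be \<open>-1\<close>, would express that entry as a signed sum of the later ones. The
  recursive form suits both induction and computation.
\<close>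
primrec dissociated :: "('a, 'b) monoid_scheme \<Rightarrow> 'a list \<Rightarrow> bool" where
  "dissociated G [] \<longleftrightarrow> True"
| "dissociated G (g # gs) \<longleftrightarrow> g \<notin> signed_sums G gs \<and> dissociated G gs"

text \<open>The binary digits of \<open>c\<close>, least significant first, select the entries that are added.\<close>
primrec subset_sum :: "('a, 'b) monoid_scheme \<Rightarrow> 'a list \<Rightarrow> nat \<Rightarrow> 'a" where
  "subset_sum G [] c = \<one>\<^bsub>G\<^esub>"
| "subset_sum G (g # gs) c = g [^]\<^bsub>G\<^esub> (c mod 2) \<otimes>\<^bsub>G\<^esub> subset_sum G gs (c div 2)"

context comm_group
begin

lemma signed_sums_closed: "set gs \<subseteq> carrier G \<Longrightarrow> signed_sums G gs \<subseteq> carrier G"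
  by (induction gs) auto

lemma inv_in_signed_sums:
  "set gs \<subseteq> carrier G \<Longrightarrow> s \<in> signed_sums G gs \<Longrightarrow> inv s \<in> signed_sums G gs"
proof (induction gs arbitrary: s)
  case Nil
  then show ?case by simp
next
  case (Cons g gs)
  then obtain t where t: "t \<in> signed_sums G gs" and s: "s = t \<or> s = g \<otimes> t \<or> s = inv g \<otimes> t"
    by auto
  have [simp]: "g \<in> carrier G" "t \<in> carrier G"
    using Cons.prems t signed_sums_closed[of gs] by auto
  from s have "inv s \<in> {inv t, g \<otimes> inv t, inv g \<otimes> inv t}"
    by (elim disjE) (simp_all add: inv_mult)
  moreover have "inv t \<in> signed_sums G gs" using Cons t by simp
  ultimately show ?case unfolding signed_sums.simps by (rule UN_I[rotated])
qed

text \<open>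
  This form of the recursion turns membership of a given element into a search that never builds the set.
\<close>
lemma mem_signed_sums_Cons:
  assumes "g \<in> carrier G" "set gs \<subseteq> carrier G" "x \<in> carrier G"
  shows "x \<in> signed_sums G (g # gs) \<longleftrightarrow>
    x \<in> signed_sums G gs \<or> g \<otimes> x \<in> signed_sums G gs \<or> inv g \<otimes> x \<in> signed_sums G gs"
proof
  assume "x \<in> signed_sums G (g # gs)"
  then obtain t where t: "t \<in> signed_sums G gs" and x: "x = t \<or> x = g \<otimes> t \<or> x = inv g \<otimes> t"
    by auto
  have [simp]: "t \<in> carrier G" using assms t signed_sums_closed[of gs] by auto
  from x show "x \<in> signed_sums G gs \<or> g \<otimes> x \<in> signed_sums G gs \<or> inv g \<otimes> x \<in> signed_sums G gs"
    using t assms(1) by (auto simp: m_assoc[symmetric])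
next
  have "x = inv g \<otimes> (g \<otimes> x)" "x = g \<otimes> (inv g \<otimes> x)"
    using assms(1,3) by (simp_all add: m_assoc[symmetric])
  then show "x \<in> signed_sums G (g # gs)"
    if "x \<in> signed_sums G gs \<or> g \<otimes> x \<in> signed_sums G gs \<or> inv g \<otimes> x \<in> signed_sums G gs"
    using that by auto
qed

lemma subset_sum_closed: "set gs \<subseteq> carrier G \<Longrightarrow> subset_sum G gs c \<in> carrier G"
  by (induction gs arbitrary: c) auto

lemma subset_sum_diff_in_signed_sums:
  "set gs \<subseteq> carrier G \<Longrightarrow> subset_sum G gs c \<otimes> inv (subset_sum G gs d) \<in> signed_sums G gs"
proof (induction gs arbitrary: c d)
  case Nil
  then show ?case by simp
next
  case (Cons g gs)
  define s t where "s = subset_sum G gs (c div 2)" and "t = subset_sum G gs (d div 2)"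
  have g: "g \<in> carrier G" and st [simp]: "s \<in> carrier G" "t \<in> carrier G"
    using Cons.prems by (auto simp: s_def t_def subset_sum_closed)
  have IH: "s \<otimes> inv t \<in> signed_sums G gs"
    using Cons by (simp add: s_def t_def)
  have "g [^] m \<otimes> s \<otimes> inv (g [^] n \<otimes> t) = g [^] m \<otimes> inv (g [^] n) \<otimes> (s \<otimes> inv t)" for m n :: nat
    using g by (simp add: inv_mult m_ac)
  moreover have "c mod 2 = 0 \<or> c mod 2 = 1" "d mod 2 = 0 \<or> d mod 2 = 1" by auto
  ultimately have "subset_sum G (g # gs) c \<otimes> inv (subset_sum G (g # gs) d) \<in>
      {s \<otimes> inv t, g \<otimes> (s \<otimes> inv t), inv g \<otimes> (s \<otimes> inv t)}"
    using g by (auto simp flip: s_def t_def )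
  with IH show ?case by auto
qed

lemma subset_sum_inj:
  assumes "dissociated G gs" "set gs \<subseteq> carrier G"
  shows "inj_on (subset_sum G gs) {..<2 ^ length gs}"
  using assms
proof (induction gs)
  case Nil
  then show ?case by (simp add: inj_on_def)
next
  case (Cons g gs)
  have g: "g \<in> carrier G" and gs: "set gs \<subseteq> carrier G" using Cons.prems by auto
  have IH: "inj_on (subset_sum G gs) {..<2 ^ length gs}" using Cons by simp
  \<comment> \<open>If exactly one of two equal subset sums uses \<open>g\<close>, then \<open>g\<close> is a difference of subset sums of \<open>gs\<close>.\<close>
  have no: False if "g \<otimes> subset_sum G gs c = subset_sum G gs d" for c d
  proof -
    have "g = subset_sum G gs d \<otimes> inv (subset_sum G gs c)"
      using that g gs by (simp add: inv_solve_right subset_sum_closed)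
    then show False
      using Cons.prems subset_sum_diff_in_signed_sums[OF gs] by auto
  qed
  show ?case
  proof (rule inj_onI)
    fix c d assume c: "c \<in> {..<2 ^ length (g # gs)}" and d: "d \<in> {..<2 ^ length (g # gs)}"
      and eq: "subset_sum G (g # gs) c = subset_sum G (g # gs) d"
    have par: "c mod 2 = d mod 2"
    proof (rule ccontr)
      assume "c mod 2 \<noteq> d mod 2"
      then consider "c mod 2 = 1" "d mod 2 = 0" | "c mod 2 = 0" "d mod 2 = 1" by linarith
      then show False
      proof cases
        case 1
        then have "g \<otimes> subset_sum G gs (c div 2) = subset_sum G gs (d div 2)"
          using eq g gs by (simp add: subset_sum_closed)
        then show False by (rule no)
      next
        case 2
        then have "g \<otimes> subset_sum G gs (d div 2) = subset_sum G gs (c div 2)"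
          using eq g gs by (simp add: subset_sum_closed)
        then show False by (rule no)
      qed
    qed
    then have "subset_sum G gs (c div 2) = subset_sum G gs (d div 2)"
      using eq g gs by (simp add: subset_sum_closed)
    moreover have "c div 2 < 2 ^ length gs" "d div 2 < 2 ^ length gs"
      using c d by auto
    ultimately have "c div 2 = d div 2"
      using inj_onD[OF IH] by simp
    with par show "c = d" by (metis div_mult_mod_eq)
  qed
qed

lemma subset_sum_map_diff:
  assumes "\<And>x. x \<in> set xs \<Longrightarrow> f x \<in> carrier G" "\<And>x. x \<in> set xs \<Longrightarrow> h x \<in> carrier G"
  shows "subset_sum G (map f xs) c \<otimes> inv (subset_sum G (map h xs) c) =
    subset_sum G (map (\<lambda>x. f x \<otimes> inv (h x)) xs) c"
  using assms
proof (induction xs arbitrary: c)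
  case Nil
  then show ?case by simp
next
  case (Cons x xs)
  have [simp]: "f x \<in> carrier G" "h x \<in> carrier G"
    "subset_sum G (map f xs) d \<in> carrier G" "subset_sum G (map h xs) d \<in> carrier G" for d
    using Cons.prems by (auto intro!: subset_sum_closed)
  have "subset_sum G (map f (x # xs)) c \<otimes> inv (subset_sum G (map h (x # xs)) c) =
     (f x \<otimes> inv (h x)) [^] (c mod 2) \<otimes>
     (subset_sum G (map f xs) (c div 2) \<otimes> inv (subset_sum G (map h xs) (c div 2)))"
    by (simp add: inv_mult m_ac nat_pow_distrib nat_pow_inv)
  then show ?case using Cons by simp
qed

end

section \<open>From dissociated row combinations to contracted difference matrices\<close>

definition row_combination ::
    "('a, 'b) monoid_scheme \<Rightarrow> nat \<Rightarrow> (nat \<Rightarrow> int) \<Rightarrow> (nat \<Rightarrow> 'a) \<Rightarrow> 'a" where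
  "row_combination G k a c = finprod G (\<lambda>i. c i [^]\<^bsub>G\<^esub> a i) {..<k}"

definition sign_coefficients :: "nat \<Rightarrow> (nat \<Rightarrow> int) set" where
  "sign_coefficients k = {a. (\<forall>i<k. a i \<in> {-1, 0, 1}) \<and> (\<exists>i<k. a i \<noteq> 0)}"

text \<open>
  A matrix with \<open>k\<close> rows is kept as the list of its columns, so that matrices are juxtaposed by appending
  lists. The sequence \<open>map (row_combination G k a) cs\<close> is the row vector \<open>a M\<close>.
\<close>
definition contracted_columns ::
    "('a, 'b) monoid_scheme \<Rightarrow> nat \<Rightarrow> (nat \<Rightarrow> 'a) list \<Rightarrow> bool" where
  "contracted_columns G k cs \<longleftrightarrow>
     comm_group G \<and> order G = 2 ^ length cs \<and>
     (\<forall>c\<in>set cs. \<forall>i<k. c i \<in> carrier G) \<and>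
     (\<forall>a\<in>sign_coefficients k. dissociated G (map (row_combination G k a) cs))"

lemma (in comm_group) row_combination_closed:
  "\<forall>i<k. c i \<in> carrier G \<Longrightarrow> row_combination G k a c \<in> carrier G"
  unfolding row_combination_def by (intro finprod_closed) auto

lemma (in comm_group) finprod_inv:
  assumes "f \<in> A \<rightarrow> carrier G"
  shows "finprod G (\<lambda>x. inv (f x)) A = inv (finprod G f A)"
  using assms by (induction A rule: infinite_finite_induct) (auto simp: inv_mult Pi_def)

lemma (in comm_group) row_combination_diff:
  assumes "\<forall>i<k. c i \<in> carrier G"
  shows "row_combination G k a c \<otimes> inv (row_combination G k b c) =
    row_combination G k (\<lambda>i. a i - b i) c"
proof -
  have "row_combination G k (\<lambda>i. a i - b i) c =
      finprod G (\<lambda>i. c i [^] a i \<otimes> inv (c i [^] b i)) {..<k}"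
    unfolding row_combination_def using assms by (intro finprod_cong') (auto simp: int_pow_diff)
  also have "\<dots> = row_combination G k a c \<otimes> finprod G (\<lambda>i. inv (c i [^] b i)) {..<k}"
    unfolding row_combination_def using assms by (subst finprod_multf) auto
  also have "finprod G (\<lambda>i. inv (c i [^] b i)) {..<k} = inv (row_combination G k b c)"
    unfolding row_combination_def using assms by (intro finprod_inv) auto
  finally show ?thesis by simp
qed

text \<open>
  An entry of the expansion is a bilinear form in the digits of its row and column index. Summing over the rows first
  exhibits it as a subset sum of a row combination.
\<close>
lemma (in comm_group) finprod_eq_subset_sum:
  assumes "\<forall>c\<in>set cs. \<forall>i<k. c i \<in> carrier G"
  shows "finprod G (\<lambda>(i, j). (cs ! j) i [^] (f i * digit 2 x j)) ({..<k} \<times> {..<length cs}) =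
    subset_sum G (map (row_combination G k (\<lambda>i. int (f i))) cs) x"
  using assms
proof (induction cs arbitrary: x)
  case Nil
  then show ?case by simp
next
  case (Cons c cs)
  let ?F = "\<lambda>(i, j). ((c # cs) ! j) i [^] (f i * digit 2 x j)"
  have c: "c i \<in> carrier G" if "i < k" for i using Cons.prems that by simp
  have cs: "(cs ! j) i \<in> carrier G" if "i < k" "j < length cs" for i j
    using Cons.prems that by (auto simp: all_set_conv_all_nth)
  have split: "{..<k} \<times> {..<length (c # cs)} =
      (\<lambda>i. (i, 0)) ` {..<k} \<union> (\<lambda>(i, j). (i, Suc j)) ` ({..<k} \<times> {..<length cs})"
    by (auto simp: image_iff lessThan_Suc_eq_insert_0)
  have "finprod G ?F ({..<k} \<times> {..<length (c # cs)}) =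
      finprod G ?F ((\<lambda>i. (i, 0)) ` {..<k}) \<otimes>
      finprod G ?F ((\<lambda>(i, j). (i, Suc j)) ` ({..<k} \<times> {..<length cs}))"
    unfolding split by (rule finprod_Un_disjoint) (auto simp: c cs)
  also have "finprod G ?F ((\<lambda>i. (i, 0)) ` {..<k}) = finprod G (\<lambda>i. c i [^] (f i * (x mod 2))) {..<k}"
    by (subst finprod_reindex) (auto simp: inj_on_def c digit_def intro!: finprod_cong')
  also have "\<dots> = finprod G (\<lambda>i. c i [^] f i) {..<k} [^] (x mod 2)"
  proof -
    have "x mod 2 = 0 \<or> x mod 2 = 1" by auto
    then show ?thesis using c by (auto intro!: finprod_one_eqI finprod_closed)
  qed
  also have "finprod G (\<lambda>i. c i [^] f i) {..<k} = row_combination G k (\<lambda>i. int (f i)) c"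
    unfolding row_combination_def using c by (intro finprod_cong') (auto simp: int_pow_int)
  also have "finprod G ?F ((\<lambda>(i, j). (i, Suc j)) ` ({..<k} \<times> {..<length cs})) =
      finprod G (\<lambda>(i, j). (cs ! j) i [^] (f i * digit 2 (x div 2) j)) ({..<k} \<times> {..<length cs})"
    by (subst finprod_reindex)
      (auto simp: inj_on_def cs digit_def div_mult2_eq intro!: finprod_cong')
  also have "\<dots> = subset_sum G (map (row_combination G k (\<lambda>i. int (f i))) cs) (x div 2)"
    using Cons by simp
  finally show ?case by simp
qed

text \<open>
  The difference of rows \<open>r\<close> and \<open>s\<close> of the expansion is the map from column indices to subset sums of the row
  combination with coefficients \<open>r - s\<close>. It is injective by \<open>subset_sum_inj\<close>, hence bijective because there are as
  many columns as group elements.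
\<close>
theorem contracted_columns_imp_contracted_difference_matrix:
  fixes G (structure)
  assumes cs: "contracted_columns G k cs" and ne: "cs \<noteq> []"
  shows "contracted_difference_matrix 2 G k 0 (mat k (length cs) (\<lambda>(i, j). (cs ! j) i))"
proof -
  let ?n = "length cs" and ?M = "mat k (length cs) (\<lambda>(i, j). (cs ! j) i)"
  let ?E = "p_expansion 2 G ?M"
  have grp: "comm_group G" and ord: "order G = 2 ^ ?n"
    and mem: "\<forall>c\<in>set cs. \<forall>i<k. c i \<in> carrier G"
    and dis: "\<And>a. a \<in> sign_coefficients k \<Longrightarrow> dissociated G (map (row_combination G k a) cs)"
    using cs by (auto simp: contracted_columns_def)
  interpret comm_group G by (fact grp)
  have fin: "finite (carrier G)"
    using ord by (auto simp: order_def intro: card_ge_0_finite)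
  have memn: "(cs ! j) i \<in> carrier G" if "i < k" "j < ?n" for i j
    using mem that by (auto simp: all_set_conv_all_nth)
  define R where "R r = map (row_combination G k (\<lambda>i. int (digit 2 r i))) cs" for r
  have R: "set (R r) \<subseteq> carrier G" for r
    using mem by (auto simp: R_def intro!: row_combination_closed)
  have E: "?E $$ (r, c) = subset_sum G (R r) c" if "r < 2 ^ k" "c < 2 ^ ?n" for r c
  proof -
    have "?E $$ (r, c) = finprod G (\<lambda>(i, j). (cs ! j) i [^] (digit 2 r i * digit 2 c j))
        ({..<k} \<times> {..<?n})"
      using that by (auto simp: p_expansion_def memn intro!: finprod_cong')
    also have "\<dots> = subset_sum G (R r) c"
      unfolding R_def by (rule finprod_eq_subset_sum[OF mem])
    finally show ?thesis .
  qed
  have "count {#?E $$ (r, c) \<otimes> inv (?E $$ (s, c)). c \<in># mset_set {0..<1 * order G}#} g = 1"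
    if rs: "r < 2 ^ k" "s < 2 ^ k" "r \<noteq> s" and g: "g \<in> carrier G" for r s g
  proof -
    define a where "a i = int (digit 2 r i) - int (digit 2 s i)" for i
    define D where "D = map (row_combination G k a) cs"
    have D: "set D \<subseteq> carrier G" "length D = ?n"
      using mem by (auto simp: D_def intro!: row_combination_closed)
    have "a i \<in> {-1, 0, 1}" for i
      using mod_less_divisor[of 2 "r div 2 ^ i"] mod_less_divisor[of 2 "s div 2 ^ i"]
      by (auto simp: a_def digit_def)
    moreover have "\<exists>i<k. a i \<noteq> 0"
      using digits_eqD[of r 2 k s] rs by (auto simp: a_def)
    ultimately have "dissociated G D"
      unfolding D_def by (intro dis) (simp add: sign_coefficients_def)
    then have inj: "inj_on (subset_sum G D) {..<2 ^ ?n}"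
      using subset_sum_inj[of D] D by simp
    have "subset_sum G D ` {..<2 ^ ?n} = carrier G"
    proof (rule card_subset_eq[OF fin])
      show "card (subset_sum G D ` {..<2 ^ ?n}) = card (carrier G)"
        using ord by (simp add: card_image[OF inj] order_def)
    qed (use D in \<open>auto intro!: subset_sum_closed\<close>)
    then obtain c where c: "c < 2 ^ ?n" "subset_sum G D c = g"
      using g by (metis imageE lessThan_iff)
    have diff: "?E $$ (r, x) \<otimes> inv (?E $$ (s, x)) = subset_sum G D x" if "x < 2 ^ ?n" for x
    proof -
      have "?E $$ (r, x) \<otimes> inv (?E $$ (s, x)) =
          subset_sum G (map (\<lambda>c. row_combination G k (\<lambda>i. int (digit 2 r i)) c \<otimes>
            inv (row_combination G k (\<lambda>i. int (digit 2 s i)) c)) cs) x"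
        using mem rs that unfolding E[OF rs(1) that] E[OF rs(2) that] R_def
        by (intro subset_sum_map_diff row_combination_closed) auto
      also have "\<dots> = subset_sum G D x"
        unfolding D_def a_def using mem
        by (intro arg_cong[where f = "\<lambda>l. subset_sum G l x"] map_cong refl row_combination_diff) auto
      finally show ?thesis .
    qed
    have "{x. x \<in># mset_set {0..<1 * order G} \<and> g = ?E $$ (r, x) \<otimes> inv (?E $$ (s, x))} = {c}"
      using c diff ord inj_onD[OF inj] by auto
    then show ?thesis
      using c ord by (simp only: count_image_mset') simp
  qed
  note count = this
  have "carrier G \<noteq> {\<one>}"
  proof
    assume "carrier G = {\<one>}"
    then have "(2::nat) ^ ?n = 1" using ord by (simp add: order_def)
    then show False using ne by simp
  qed
  moreover have "elements_mat ?E \<subseteq> carrier G"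
  proof
    fix y assume "y \<in> elements_mat ?E"
    then obtain r c where "r < 2 ^ k" "c < 2 ^ ?n" "y = ?E $$ (r, c)"
      by (auto simp: elements_mat_def p_expansion_def)
    then show "y \<in> carrier G" using E R by (simp add: subset_sum_closed)
  qed
  moreover have "?E \<in> carrier_mat (2 ^ k) (1 * order G)"
    using ord by (simp add: p_expansion_def)
  ultimately have "difference_matrix G (2 ^ k) 1 ?E"
    unfolding difference_matrix_def using fin count by (auto intro: is_group)
  moreover have "elements_mat ?M \<subseteq> carrier G"
    by (auto simp: elements_mat_def memn)
  ultimately show ?thesis
    unfolding contracted_difference_matrix_def using grp ord by auto
qed

section \<open>Group extensions\<close>

lemma hom_finprod:
  assumes "comm_group G" "comm_group H" "f \<in> hom G H" "x \<in> A \<rightarrow> carrier G"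
  shows "f (finprod G x A) = finprod H (\<lambda>i. f (x i)) A"
proof -
  interpret G: comm_group G by fact
  interpret H: comm_group H by fact
  interpret group_hom G H f using assms(3) by unfold_locales
  show ?thesis using assms(4)
    by (induction A rule: infinite_finite_induct) (auto simp: Pi_def)
qed

lemma hom_row_combination:
  assumes "comm_group G" "comm_group H" "f \<in> hom G H" "\<forall>i<k. c i \<in> carrier G"
  shows "f (row_combination G k a c) = row_combination H k a (\<lambda>i. f (c i))"
proof -
  interpret G: comm_group G by fact
  interpret H: comm_group H by fact
  interpret group_hom G H f using assms(3) by unfold_locales
  have "f (row_combination G k a c) = finprod H (\<lambda>i. f (c i [^]\<^bsub>G\<^esub> a i)) {..<k}"
    unfolding row_combination_def using assms by (intro hom_finprod) auto
  also have "\<dots> = row_combination H k a (\<lambda>i. f (c i))"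
    unfolding row_combination_def using assms(4)
    by (intro H.finprod_cong') (auto simp: hom_int_pow)
  finally show ?thesis .
qed

lemma hom_signed_sums:
  assumes "group G" "group H" "f \<in> hom G H" "set gs \<subseteq> carrier G"
  shows "signed_sums H (map f gs) = f ` signed_sums G gs"
  using assms(4)
proof (induction gs)
  interpret group_hom G H f using assms(1-3) by (simp add: group_hom_def group_hom_axioms_def)
  case Nil
  show ?case by simp
next
  interpret group_hom G H f using assms(1-3) by (simp add: group_hom_def group_hom_axioms_def)
  case (Cons g gs)
  have "signed_sums G gs \<subseteq> carrier G"
  proof -
    have "set gs \<subseteq> carrier G" using Cons.prems by simp
    then show ?thesis by (induction gs) auto
  qed
  then have "f (g \<otimes>\<^bsub>G\<^esub> s) = f g \<otimes>\<^bsub>H\<^esub> f s" "f (inv\<^bsub>G\<^esub> g \<otimes>\<^bsub>G\<^esub> s) = inv\<^bsub>H\<^esub> f g \<otimes>\<^bsub>H\<^esub> f s"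
    if "s \<in> signed_sums G gs" for s
    using that Cons.prems by auto
  with Cons show ?case by (simp add: image_UN)
qed

lemma dissociated_hom_inj:
  assumes "comm_group G" "comm_group H" "f \<in> hom G H" "inj_on f (carrier G)"
    and "set gs \<subseteq> carrier G" "dissociated G gs"
  shows "dissociated H (map f gs)"
  using assms(5,6)
proof (induction gs)
  case (Cons g gs)
  interpret G: comm_group G by fact
  have "f g \<notin> f ` signed_sums G gs"
    using Cons.prems assms(4) G.signed_sums_closed[of gs]
    by (auto dest!: inj_onD)
  moreover have "signed_sums H (map f gs) = f ` signed_sums G gs"
    using Cons.prems assms by (intro hom_signed_sums) (auto simp: comm_group.axioms(2))
  ultimately show ?case using Cons by simp
qed simp

lemma signed_sums_append_ones:
  assumes "group G" "set gs \<subseteq> carrier G" "set hs \<subseteq> {\<one>\<^bsub>G\<^esub>}"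
  shows "signed_sums G (gs @ hs) = signed_sums G gs"
proof -
  interpret group G by fact
  have "signed_sums G hs = {\<one>\<^bsub>G\<^esub>}" using assms(3) by (induction hs) auto
  then show ?thesis by (induction gs) auto
qed

text \<open>
  A relation that expresses an entry of \<open>gs\<close> by later entries survives the map to \<open>Q\<close>, where the entries of \<open>hs\<close>
  disappear; this contradicts the assumption on \<open>map f gs\<close>.
\<close>
lemma dissociated_append:
  assumes "comm_group G" "comm_group Q" "f \<in> hom G Q"
    and "set gs \<subseteq> carrier G" "set hs \<subseteq> carrier G" "f ` set hs \<subseteq> {\<one>\<^bsub>Q\<^esub>}"
    and "dissociated Q (map f gs)" "dissociated G hs"
  shows "dissociated G (gs @ hs)"
  using assms(4,7)
proof (induction gs)
  case Nil
  then show ?case using assms(8) by simp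
next
  case (Cons g gs)
  interpret G: comm_group G by fact
  interpret Q: comm_group Q by fact
  have "g \<notin> signed_sums G (gs @ hs)"
  proof
    assume "g \<in> signed_sums G (gs @ hs)"
    then have "f g \<in> signed_sums Q (map f (gs @ hs))"
      using hom_signed_sums[OF G.is_group Q.is_group assms(3), of "gs @ hs"] Cons.prems assms(5)
      by auto
    also have "\<dots> = signed_sums Q (map f gs)"
      unfolding map_append using Cons.prems assms(3,6)
      by (intro signed_sums_append_ones Q.is_group) (auto simp: hom_def Pi_def)
    finally show False using Cons.prems by simp
  qed
  with Cons show ?case by simp
qed

text \<open>
  The juxtaposition of lifts of the columns for \<open>Q\<close> and images of the columns for \<open>H\<close>. Exactness in the middle
  follows from the orders, so it is enough that \<open>\<pi> \<circ> \<phi>\<close> is trivial.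
\<close>
theorem contracted_columns_extension:
  assumes Q: "contracted_columns Q k cs" and H: "contracted_columns H k ds"
    and G: "comm_group G" and ord: "order G = order Q * order H"
    and \<phi>: "\<phi> \<in> hom H G" "inj_on \<phi> (carrier H)"
    and \<pi>: "\<pi> \<in> hom G Q" "\<pi> ` carrier G = carrier Q"
    and triv: "\<And>h. h \<in> carrier H \<Longrightarrow> \<pi> (\<phi> h) = \<one>\<^bsub>Q\<^esub>"
  shows "\<exists>es. contracted_columns G k es"
proof -
  interpret G: comm_group G by fact
  interpret Q: comm_group Q using Q by (simp add: contracted_columns_def)
  interpret H: comm_group H using H by (simp add: contracted_columns_def)
  define lift where "lift q = inv_into (carrier G) \<pi> q" for q
  have lift: "lift q \<in> carrier G" "\<pi> (lift q) = q" if "q \<in> carrier Q" for q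
    using that \<pi>(2) by (auto simp: lift_def inv_into_into f_inv_into_f)
  define cs' where "cs' = map (\<lambda>c i. lift (c i)) cs"
  define ds' where "ds' = map (\<lambda>d i. \<phi> (d i)) ds"
  have Qc: "\<forall>c\<in>set cs. \<forall>i<k. c i \<in> carrier Q" and Hc: "\<forall>d\<in>set ds. \<forall>i<k. d i \<in> carrier H"
    using Q H by (simp_all add: contracted_columns_def)
  have Gc: "\<forall>c\<in>set cs'. \<forall>i<k. c i \<in> carrier G" and Gd: "\<forall>d\<in>set ds'. \<forall>i<k. d i \<in> carrier G"
    using Qc Hc lift \<phi>(1) by (auto simp: cs'_def ds'_def hom_def Pi_def)
  have "dissociated G (map (row_combination G k a) (cs' @ ds'))" if a: "a \<in> sign_coefficients k" for a
    unfolding map_append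
  proof (rule dissociated_append[OF G Q.comm_group_axioms \<pi>(1)])
    have "\<pi> (row_combination G k a (\<lambda>i. lift (c i))) = row_combination Q k a c" if "c \<in> set cs" for c
    proof -
      have "\<pi> (row_combination G k a (\<lambda>i. lift (c i))) =
          row_combination Q k a (\<lambda>i. \<pi> (lift (c i)))"
        using that Qc lift
        by (intro hom_row_combination[OF G Q.comm_group_axioms \<pi>(1)]) auto
      also have "\<dots> = row_combination Q k a c"
        unfolding row_combination_def using that Qc lift by (intro Q.finprod_cong') auto
      finally show ?thesis .
    qed
    then have "map \<pi> (map (row_combination G k a) cs') = map (row_combination Q k a) cs"
      by (simp add: cs'_def)
    then show "dissociated Q (map \<pi> (map (row_combination G k a) cs'))"
      using Q a by (simp add: contracted_columns_def)
    have eq: "map (row_combination G k a) ds' = map \<phi> (map (row_combination H k a) ds)"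
      using Hc by (simp add: ds'_def hom_row_combination[OF H.comm_group_axioms G \<phi>(1)])
    show "dissociated G (map (row_combination G k a) ds')"
      unfolding eq using H a Hc
      by (intro dissociated_hom_inj[OF H.comm_group_axioms G \<phi>])
        (auto simp: contracted_columns_def intro!: H.row_combination_closed)
    have "set (map (row_combination H k a) ds) \<subseteq> carrier H"
      using Hc by (auto intro!: H.row_combination_closed)
    then show "\<pi> ` set (map (row_combination G k a) ds') \<subseteq> {\<one>\<^bsub>Q\<^esub>}"
      unfolding eq using triv by auto
  qed (use Gc Gd in \<open>auto intro!: G.row_combination_closed\<close>)
  moreover have "order G = 2 ^ length (cs' @ ds')"
    using ord Q H by (simp add: contracted_columns_def cs'_def ds'_def power_add)
  ultimately have "contracted_columns G k (cs' @ ds')"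
    using G Gc Gd by (auto simp: contracted_columns_def)
  then show ?thesis ..
qed

lemma contracted_columns_iso:
  assumes "contracted_columns G k cs" "comm_group H" "f \<in> iso G H"
  shows "contracted_columns H k (map (\<lambda>c i. f (c i)) cs)"
proof -
  interpret G: comm_group G using assms by (simp add: contracted_columns_def)
  have f: "f \<in> hom G H" "bij_betw f (carrier G) (carrier H)" using assms by (auto simp: iso_def)
  have c: "\<forall>c\<in>set cs. \<forall>i<k. c i \<in> carrier G" using assms by (simp add: contracted_columns_def)
  have "dissociated H (map (row_combination H k a) (map (\<lambda>c i. f (c i)) cs))"
    if a: "a \<in> sign_coefficients k" for a
  proof -
    have "map (row_combination H k a) (map (\<lambda>c i. f (c i)) cs) = map f (map (row_combination G k a) cs)"
      using c by (simp add: hom_row_combination[OF G.comm_group_axioms assms(2) f(1)])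
    then show ?thesis
      using assms a f c
      by (auto simp: contracted_columns_def bij_betw_def simp del: map_map
          intro!: dissociated_hom_inj[OF G.comm_group_axioms assms(2) f(1)] G.row_combination_closed)
  qed
  moreover have "order H = order G" using f(2) by (simp add: order_def bij_betw_same_card)
  ultimately show ?thesis
    using assms c f(1) by (auto simp: contracted_columns_def hom_def Pi_def)
qed

lemma group_exponent_iso:
  assumes "group G" "group H" "f \<in> iso G H"
  shows "group_exponent H = group_exponent G"
proof -
  interpret group_hom G H f using assms by (simp add: group_hom_def group_hom_axioms_def iso_def)
  have bij: "inj_on f (carrier G)" "carrier H = f ` carrier G"
    using assms(3) by (auto simp: iso_def bij_betw_def)
  have "f x [^]\<^bsub>H\<^esub> m = \<one>\<^bsub>H\<^esub> \<longleftrightarrow> x [^]\<^bsub>G\<^esub> m = \<one>\<^bsub>G\<^esub>" if "x \<in> carrier G" for x and m :: nat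
    using that inj_onD[OF bij(1), of "x [^]\<^bsub>G\<^esub> m" "\<one>\<^bsub>G\<^esub>"] by (auto simp flip: hom_nat_pow)
  then have "(\<forall>y\<in>carrier H. y [^]\<^bsub>H\<^esub> m = \<one>\<^bsub>H\<^esub>) \<longleftrightarrow> (\<forall>x\<in>carrier G. x [^]\<^bsub>G\<^esub> m = \<one>\<^bsub>G\<^esub>)" for m :: nat
    by (simp add: bij(2))
  then show ?thesis by (simp add: group_exponent_def)
qed

lemma iso_image_group:
  assumes "comm_group G" "inj_on f (carrier G)"
  shows "f \<in> iso G (image_group f G)" "comm_group (image_group f G)"
proof -
  interpret comm_group G by fact
  show iso: "f \<in> iso G (image_group f G)"
    using assms(2) by (auto simp: iso_def hom_def image_group_def bij_betw_def)
  show "comm_group (image_group f G)"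
    using iso_imp_img_comm_group[OF iso] by (simp add: image_group_def)
qed

section \<open>The product of a cyclic and an elementary abelian 2-group\<close>

text \<open>
  The elementary abelian group of order \<open>2 ^ l\<close>, with bit strings stored as integers. Shifting and truncating bits then
  give the embeddings and projections between these groups for different \<open>l\<close>.
\<close>
definition xor_group :: "nat \<Rightarrow> int monoid" where
  "xor_group l = \<lparr>carrier = {0..<2 ^ l}, mult = xor, one = 0\<rparr>"

lemma xor_group_simps [simp]:
  "carrier (xor_group l) = {0..<2 ^ l}" "x \<otimes>\<^bsub>xor_group l\<^esub> y = xor x y" "\<one>\<^bsub>xor_group l\<^esub> = 0"
  by (simp_all add: xor_group_def)

lemma xor_less_power:
  "x \<in> {0..<2 ^ l} \<Longrightarrow> y \<in> {0..<2 ^ l} \<Longrightarrow> xor x y \<in> {0..<2 ^ l}" for x y :: int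
  by (metis atLeastLessThan_iff take_bit_int_eq_self_iff take_bit_xor)

lemma comm_group_xor_group: "comm_group (xor_group l)"
proof (rule comm_groupI)
  show "x \<otimes>\<^bsub>xor_group l\<^esub> y \<in> carrier (xor_group l)"
    if "x \<in> carrier (xor_group l)" "y \<in> carrier (xor_group l)" for x y
    using that xor_less_power[of x l y] by simp
  show "\<exists>y\<in>carrier (xor_group l). y \<otimes>\<^bsub>xor_group l\<^esub> x = \<one>\<^bsub>xor_group l\<^esub>"
    if "x \<in> carrier (xor_group l)" for x
    using that by (intro bexI[of _ x]) simp_all
qed (simp_all add: ac_simps)

lemma inv_xor_group: "x \<in> carrier (xor_group l) \<Longrightarrow> inv\<^bsub>xor_group l\<^esub> x = x"
  by (intro group.inv_equality comm_group.axioms(2)[OF comm_group_xor_group]) simp_all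

definition dyadic_group :: "nat \<Rightarrow> nat \<Rightarrow> (int \<times> int) monoid" where
  "dyadic_group e l = integer_mod_group (2 ^ e) \<times>\<times> xor_group l"

lemma carrier_dyadic_group: "carrier (dyadic_group e l) = {0..<2 ^ e} \<times> {0..<2 ^ l}"
  by (simp add: dyadic_group_def carrier_integer_mod_group)

lemma one_dyadic_group [simp]: "\<one>\<^bsub>dyadic_group e l\<^esub> = (0, 0)"
  by (simp add: dyadic_group_def)

lemma mult_dyadic_group [simp]:
  "(u, v) \<otimes>\<^bsub>dyadic_group e l\<^esub> (u', v') = ((u + u') mod 2 ^ e, xor v v')"
  by (simp add: dyadic_group_def)

lemma comm_group_dyadic_group: "comm_group (dyadic_group e l)"
  unfolding dyadic_group_def
proof (rule group.group_comm_groupI[OF DirProd_group])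
  show "x \<otimes>\<^bsub>integer_mod_group (2 ^ e) \<times>\<times> xor_group l\<^esub> y =
      y \<otimes>\<^bsub>integer_mod_group (2 ^ e) \<times>\<times> xor_group l\<^esub> x" for x y
    by (simp add: mult_DirProd' ac_simps)
qed (simp_all add: comm_group.axioms(2)[OF comm_group_xor_group])

lemma order_dyadic_group: "order (dyadic_group e l) = 2 ^ (e + l)"
  by (simp add: order_def carrier_dyadic_group power_add card_cartesian_product nat_power_eq)

lemma inv_dyadic_group:
  "(u, v) \<in> carrier (dyadic_group e l) \<Longrightarrow> inv\<^bsub>dyadic_group e l\<^esub> (u, v) = ((- u) mod 2 ^ e, v)"
  by (auto simp: dyadic_group_def inv_xor_group[simplified] comm_group.axioms(2)[OF comm_group_xor_group])

lemma pow_dyadic_group: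
  "(u, v) [^]\<^bsub>dyadic_group e l\<^esub> (m :: nat) = (int m * u mod 2 ^ e, if even m then 0 else v)"
  by (induction m) (auto simp: dyadic_group_def nat_pow_def algebra_simps mod_simps)

lemma group_exponent_dyadic_group:
  assumes "1 \<le> e"
  shows "group_exponent (dyadic_group e l) = 2 ^ e"
  unfolding group_exponent_def
proof (rule Least_equality)
  have "even ((2::nat) ^ e)" using assms by simp
  then show "0 < (2::nat) ^ e \<and>
      (\<forall>x\<in>carrier (dyadic_group e l). x [^]\<^bsub>dyadic_group e l\<^esub> ((2::nat) ^ e) = \<one>\<^bsub>dyadic_group e l\<^esub>)"
    by (auto simp: pow_dyadic_group)
next
  fix m :: nat
  assume m: "0 < m \<and> (\<forall>x\<in>carrier (dyadic_group e l). x [^]\<^bsub>dyadic_group e l\<^esub> m = \<one>\<^bsub>dyadic_group e l\<^esub>)"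
  moreover have "(1, 0) \<in> carrier (dyadic_group e l)"
    using assms by (simp add: carrier_dyadic_group)
  ultimately have "(1, 0) [^]\<^bsub>dyadic_group e l\<^esub> m = (0, 0)" by auto
  then have "int m mod 2 ^ e = 0" by (simp add: pow_dyadic_group)
  then have "2 ^ e dvd m" by (metis dvd_eq_mod_eq_0 int_dvd_int_iff of_nat_numeral of_nat_power)
  then show "2 ^ e \<le> m" using m by (simp add: dvd_imp_le)
qed

lemma push_bit_bounds:
  "v \<in> {0..<2 ^ m} \<Longrightarrow> push_bit l v \<in> {0..<2 ^ (l + m)}" for v :: int
  by (simp add: push_bit_eq_mult power_add mult.commute)

text \<open>
  The exact sequence is multiplication by \<open>2 ^ e\<close> followed by reduction modulo \<open>2 ^ e\<close> on the cyclic factor, and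
  shift by \<open>l\<close> bits followed by truncation to \<open>l\<close> bits on the elementary abelian factor.
\<close>
lemma dyadic_group_extension:
  assumes "contracted_columns (dyadic_group e l) k cs" "contracted_columns (dyadic_group f m) k ds"
  shows "\<exists>es. contracted_columns (dyadic_group (e + f) (l + m)) k es"
proof (rule contracted_columns_extension[OF assms comm_group_dyadic_group])
  let ?Q = "dyadic_group e l" and ?H = "dyadic_group f m" and ?G = "dyadic_group (e + f) (l + m)"
  let ?\<phi> = "\<lambda>(u, v). (2 ^ e * u, push_bit l v) :: int \<times> int"
  let ?\<pi> = "\<lambda>(u, v). (u mod 2 ^ e, take_bit l v) :: int \<times> int"
  show "order ?G = order ?Q * order ?H" by (simp add: order_dyadic_group power_add)
  show "?\<phi> \<in> hom ?H ?G"
  proof (rule homI)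
    show "?\<phi> x \<in> carrier ?G" if "x \<in> carrier ?H" for x
      using that push_bit_bounds[of "snd x" m l]
      by (auto simp: carrier_dyadic_group power_add)
    show "?\<phi> (x \<otimes>\<^bsub>?H\<^esub> y) = ?\<phi> x \<otimes>\<^bsub>?G\<^esub> ?\<phi> y" for x y
      by (cases x; cases y) (simp add: power_add mult_mod_right distrib_left push_bit_xor)
  qed
  show "inj_on ?\<phi> (carrier ?H)"
    by (auto simp: inj_on_def push_bit_eq_mult)
  show "?\<pi> \<in> hom ?G ?Q"
    by (auto intro!: homI simp: carrier_dyadic_group take_bit_xor mod_mod_cancel mod_simps
        power_add)
  have "(u, v) \<in> ?\<pi> ` carrier ?G" if "(u, v) \<in> carrier ?Q" for u v
  proof (rule image_eqI)
    show "(u, v) = ?\<pi> (u, v)" using that by (simp add: carrier_dyadic_group take_bit_int_eq_self)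
    have "u < 2 ^ (e + f)" "v < 2 ^ (l + m)"
      using that by (auto simp: carrier_dyadic_group intro: less_le_trans[of _ "2 ^ e"] less_le_trans[of _ "2 ^ l"])
    then show "(u, v) \<in> carrier ?G" using that by (simp add: carrier_dyadic_group)
  qed
  then show "?\<pi> ` carrier ?G = carrier ?Q"
    by (auto simp: carrier_dyadic_group)
  show "?\<pi> (?\<phi> h) = \<one>\<^bsub>?Q\<^esub>" if "h \<in> carrier ?H" for h
    by (cases h) (simp add: take_bit_push_bit)
qed

section \<open>Checking explicit matrices\<close>

text \<open>
  Cyclic components are computed in \<open>\<int>\<close> and reduced modulo \<open>2 ^ e\<close> only when a signed combination is complete.
  The recursion follows all choices of signs and requires that none of them yields \<open>(u, v)\<close>.
\<close>
fun avoids :: "nat \<Rightarrow> int \<Rightarrow> int \<Rightarrow> (int \<times> int) list \<Rightarrow> bool" where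
  "avoids e u v [] \<longleftrightarrow> \<not> (u mod 2 ^ e = 0 \<and> v = 0)"
| "avoids e u v ((u', v') # gs) \<longleftrightarrow>
     avoids e u v gs \<and> avoids e (u' + u) (xor v' v) gs \<and> avoids e (u - u') (xor v' v) gs"

fun dissociated_lifts :: "nat \<Rightarrow> (int \<times> int) list \<Rightarrow> bool" where
  "dissociated_lifts e [] \<longleftrightarrow> True"
| "dissociated_lifts e ((u, v) # gs) \<longleftrightarrow> avoids e u v gs \<and> dissociated_lifts e gs"

definition reduce :: "nat \<Rightarrow> int \<times> int \<Rightarrow> int \<times> int" where
  "reduce e = (\<lambda>(u, v). (u mod 2 ^ e, v))"

lemma reduce_in_carrier:
  "snd g \<in> {0..<2 ^ l} \<Longrightarrow> reduce e g \<in> carrier (dyadic_group e l)"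
  by (simp add: reduce_def carrier_dyadic_group case_prod_beta)

lemma avoids_iff:
  assumes "snd ` set gs \<subseteq> {0..<2 ^ l}" "v \<in> {0..<2 ^ l}"
  shows "avoids e u v gs \<longleftrightarrow> reduce e (u, v) \<notin> signed_sums (dyadic_group e l) (map (reduce e) gs)"
  using assms
proof (induction e u v gs rule: avoids.induct)
  case (1 e u v)
  then show ?case by (simp add: reduce_def)
next
  case (2 e u v u' v' gs)
  let ?G = "dyadic_group e l" and ?S = "signed_sums (dyadic_group e l) (map (reduce e) gs)"
  interpret comm_group ?G by (rule comm_group_dyadic_group)
  have v': "v' \<in> {0..<2 ^ l}" "xor v' v \<in> {0..<2 ^ l}" "snd ` set gs \<subseteq> {0..<2 ^ l}"
    using 2 xor_less_power[of v' l v] by auto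
  have carr: "reduce e (u', v') \<in> carrier ?G" "reduce e (u, v) \<in> carrier ?G"
    "set (map (reduce e) gs) \<subseteq> carrier ?G"
    using v' 2(5) by (auto simp: image_subset_iff simp del: atLeastLessThan_iff intro!: reduce_in_carrier)
  have "reduce e (u, v) \<in> signed_sums ?G (map (reduce e) ((u', v') # gs)) \<longleftrightarrow>
      reduce e (u, v) \<in> ?S \<or> reduce e (u', v') \<otimes>\<^bsub>?G\<^esub> reduce e (u, v) \<in> ?S \<or>
      inv\<^bsub>?G\<^esub> (reduce e (u', v')) \<otimes>\<^bsub>?G\<^esub> reduce e (u, v) \<in> ?S"
    unfolding list.map by (intro mem_signed_sums_Cons carr)
  moreover have "reduce e (u', v') \<otimes>\<^bsub>?G\<^esub> reduce e (u, v) = reduce e (u' + u, xor v' v)"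
    by (simp add: reduce_def mod_simps)
  moreover have "inv\<^bsub>?G\<^esub> (reduce e (u', v')) \<otimes>\<^bsub>?G\<^esub> reduce e (u, v) = reduce e (u - u', xor v' v)"
    using reduce_in_carrier[of "(u', v')" l e] v'
    by (simp add: reduce_def inv_dyadic_group mod_simps)
  ultimately show ?case using 2 v' by simp
qed

lemma dissociated_lifts_imp_dissociated:
  assumes "dissociated_lifts e gs" "snd ` set gs \<subseteq> {0..<2 ^ l}"
  shows "dissociated (dyadic_group e l) (map (reduce e) gs)"
  using assms by (induction e gs rule: dissociated_lifts.induct) (auto simp: avoids_iff[where l = l])

fun combine3 :: "int \<times> int \<times> int \<Rightarrow> (int \<times> int) \<times> (int \<times> int) \<times> (int \<times> int) \<Rightarrow> int \<times> int" where
  "combine3 (a, b, c) ((u, v), (u', v'), (u'', v'')) =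
     (a * u + b * u' + c * u'',
      xor (if a = 0 then 0 else v) (xor (if b = 0 then 0 else v') (if c = 0 then 0 else v'')))"

definition column3 :: "nat \<Rightarrow> (int \<times> int) \<times> (int \<times> int) \<times> (int \<times> int) \<Rightarrow> nat \<Rightarrow> int \<times> int" where
  "column3 e = (\<lambda>(x, y, z) i. reduce e ([x, y, z] ! i))"

definition rows_in_range :: "nat \<Rightarrow> (int \<times> int) \<times> (int \<times> int) \<times> (int \<times> int) \<Rightarrow> bool" where
  "rows_in_range l = (\<lambda>(x, y, z). {snd x, snd y, snd z} \<subseteq> {0..<2 ^ l})"

lemma int_pow_dyadic_group:
  assumes "v \<in> {0..<2 ^ l}" "a \<in> {-1, 0, 1}"
  shows "reduce e (u, v) [^]\<^bsub>dyadic_group e l\<^esub> a = reduce e (a * u, if a = 0 then 0 else v)"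
proof -
  interpret comm_group "dyadic_group e l" by (rule comm_group_dyadic_group)
  have mem: "reduce e (u, v) \<in> carrier (dyadic_group e l)" using assms by (simp add: reduce_in_carrier)
  show ?thesis
    using assms(2) mem by (auto simp: reduce_def int_pow_neg inv_dyadic_group mod_simps)
qed

lemma row_combination_column3:
  assumes "rows_in_range l t" "{a 0, a 1, a 2} \<subseteq> {-1, 0, 1}"
  shows "row_combination (dyadic_group e l) 3 a (column3 e t) = reduce e (combine3 (a 0, a 1, a 2) t)"
proof -
  obtain u v u' v' u'' v'' where t: "t = ((u, v), (u', v'), (u'', v''))"
    by (metis prod.exhaust)
  interpret comm_group "dyadic_group e l" by (rule comm_group_dyadic_group)
  have v: "v \<in> {0..<2 ^ l}" "v' \<in> {0..<2 ^ l}" "v'' \<in> {0..<2 ^ l}"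
    using assms by (auto simp: t rows_in_range_def)
  then have mem: "reduce e (u, v) \<in> carrier (dyadic_group e l)"
     "reduce e (u', v') \<in> carrier (dyadic_group e l)"
     "reduce e (u'', v'') \<in> carrier (dyadic_group e l)"
    by (auto intro: reduce_in_carrier)
  have "{..<3::nat} = {0, 1, 2}" by auto
  then have "row_combination (dyadic_group e l) 3 a (column3 e t) =
      reduce e (u, v) [^]\<^bsub>dyadic_group e l\<^esub> a 0 \<otimes>\<^bsub>dyadic_group e l\<^esub>
      (reduce e (u', v') [^]\<^bsub>dyadic_group e l\<^esub> a 1 \<otimes>\<^bsub>dyadic_group e l\<^esub>
       reduce e (u'', v'') [^]\<^bsub>dyadic_group e l\<^esub> a 2)"
    using mem by (simp add: row_combination_def column3_def t numeral_2_eq_2 del: one_dyadic_group)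
  also have "\<dots> = reduce e (combine3 (a 0, a 1, a 2) t)"
    using v assms(2) by (simp add: int_pow_dyadic_group t) (simp add: reduce_def mod_simps add.assoc)
  finally show ?thesis .
qed

definition signs3 :: "(int \<times> int \<times> int) list" where
  "signs3 = filter (\<lambda>a. a \<noteq> (0, 0, 0))
     (List.product [-1, 0, 1] (List.product [-1, 0, 1] [-1, 0, 1]))"

lemma set_signs3: "set signs3 = {-1, 0, 1} \<times> {-1, 0, 1} \<times> {-1, 0, 1} - {(0, 0, 0)}"
  by (auto simp: signs3_def)

lemma contracted_columns_column3:
  assumes "list_all (\<lambda>a. dissociated_lifts e (map (combine3 a) ts)) signs3"
    and "list_all (rows_in_range l) ts" "length ts = e + l"
  shows "\<exists>cs. contracted_columns (dyadic_group e l) 3 cs"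
proof -
  interpret comm_group "dyadic_group e l" by (rule comm_group_dyadic_group)
  have col: "column3 e t i \<in> carrier (dyadic_group e l)" if "t \<in> set ts" "i < 3" for t i
  proof -
    have "i = 0 \<or> i = 1 \<or> i = 2" using that by auto
    then show ?thesis
      using that assms(2)
      by (auto simp: column3_def list_all_iff rows_in_range_def case_prod_beta intro!: reduce_in_carrier)
  qed
  have "dissociated (dyadic_group e l) (map (row_combination (dyadic_group e l) 3 a) (map (column3 e) ts))"
    if a: "a \<in> sign_coefficients 3" for a
  proof -
    have signs: "a 0 \<in> {-1, 0, 1}" "a 1 \<in> {-1, 0, 1}" "a 2 \<in> {-1, 0, 1}"
      using a by (auto simp: sign_coefficients_def)
    obtain i where "i < 3" "a i \<noteq> 0" using a unfolding sign_coefficients_def by blast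
    moreover from \<open>i < 3\<close> have "i = 0 \<or> i = 1 \<or> i = 2" by auto
    ultimately have "(a 0, a 1, a 2) \<noteq> (0, 0, 0)" by auto
    with signs have "(a 0, a 1, a 2) \<in> set signs3" unfolding set_signs3 by blast
    then have "dissociated_lifts e (map (combine3 (a 0, a 1, a 2)) ts)"
      using assms(1) by (simp add: list_all_iff)
    moreover have "snd (combine3 (a 0, a 1, a 2) t) \<in> {0..<2 ^ l}" if "t \<in> set ts" for t
    proof -
      obtain u v u' v' u'' v'' where t: "t = ((u, v), (u', v'), (u'', v''))"
        by (metis prod.exhaust)
      have "v \<in> {0..<2 ^ l}" "v' \<in> {0..<2 ^ l}" "v'' \<in> {0..<2 ^ l}"
        using that assms(2) by (auto simp: t rows_in_range_def list_all_iff)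
      then have "snd (combine3 (a 0, a 1, a 2) t) =
          xor (if a 0 = 0 then 0 else v) (xor (if a 1 = 0 then 0 else v') (if a 2 = 0 then 0 else v''))"
        by (simp add: t)
      also have "\<dots> \<in> {0..<2 ^ l}"
        by (intro xor_less_power) (use \<open>v \<in> _\<close> \<open>v' \<in> _\<close> \<open>v'' \<in> _\<close> in auto)
      finally show ?thesis .
    qed
    ultimately have "dissociated (dyadic_group e l) (map (reduce e) (map (combine3 (a 0, a 1, a 2)) ts))"
      by (intro dissociated_lifts_imp_dissociated) auto
    moreover have "map (row_combination (dyadic_group e l) 3 a) (map (column3 e) ts) =
        map (reduce e) (map (combine3 (a 0, a 1, a 2)) ts)"
    proof -
      have "row_combination (dyadic_group e l) 3 a (column3 e t) = reduce e (combine3 (a 0, a 1, a 2) t)"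
        if "t \<in> set ts" for t
        using that assms(2) signs by (intro row_combination_column3) (simp_all add: list_all_iff)
      then show ?thesis by simp
    qed
    ultimately show ?thesis by (simp only:)
  qed
  then have "contracted_columns (dyadic_group e l) 3 (map (column3 e) ts)"
    using col assms(3) by (auto simp: contracted_columns_def comm_group_axioms order_dyadic_group)
  then show ?thesis ..
qed

lemmas table_simps = signs3_def rows_in_range_def

section \<open>The seed matrices and the parameters that they generate\<close>

text \<open>
  Each of the following matrices was found by a backtracking search over columns. A line is a column with its three
  entries, and an entry is a residue followed by a bit string.
\<close>
lemma contracted_columns_0_3: "\<exists>cs. contracted_columns (dyadic_group 0 3) 3 cs"
  by (rule contracted_columns_column3[where ts =
     "[((0, 5), (0, 4), (0, 6)),
      ((0, 6), (0, 1), (0, 4)),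
      ((0, 4), (0, 7), (0, 1))]"])
    (simp_all add: signs3_def rows_in_range_def)

lemma contracted_columns_1_2: "\<exists>cs. contracted_columns (dyadic_group 1 2) 3 cs"
  by (rule contracted_columns_column3[where ts =
     "[((1, 1), (1, 0), (1, 2)),
      ((1, 2), (0, 1), (1, 0)),
      ((1, 0), (1, 3), (0, 1))]"])
    (simp_all add: signs3_def rows_in_range_def)

lemma contracted_columns_2_2: "\<exists>cs. contracted_columns (dyadic_group 2 2) 3 cs"
  by (rule contracted_columns_column3[where ts =
     "[((2, 1), (3, 1), (0, 3)),
      ((1, 3), (2, 0), (2, 3)),
      ((0, 2), (0, 3), (3, 3)),
      ((0, 3), (2, 2), (0, 1))]"])
    (simp_all add: signs3_def rows_in_range_def)

lemma contracted_columns_1_3: "\<exists>cs. contracted_columns (dyadic_group 1 3) 3 cs"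
  by (rule contracted_columns_column3[where ts =
     "[((1, 6), (1, 4), (0, 4)),
      ((1, 1), (0, 4), (0, 2)),
      ((1, 2), (1, 3), (1, 1)),
      ((0, 6), (0, 2), (0, 1))]"])
    (simp_all add: signs3_def rows_in_range_def)

lemma contracted_columns_1_4: "\<exists>cs. contracted_columns (dyadic_group 1 4) 3 cs"
  by (rule contracted_columns_column3[where ts =
     "[((1, 11), (1, 15), (1, 6)),
      ((0, 12), (1, 12), (1, 2)),
      ((0, 3), (0, 12), (1, 3)),
      ((0, 5), (0, 6), (0, 10)),
      ((0, 8), (1, 1), (0, 13))]"])
    (simp_all add: signs3_def rows_in_range_def)

lemma contracted_columns_2_3: "\<exists>cs. contracted_columns (dyadic_group 2 3) 3 cs"
  by (rule contracted_columns_column3[where ts =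
     "[((2, 7), (0, 2), (2, 0)),
      ((3, 1), (0, 6), (1, 4)),
      ((1, 7), (0, 7), (2, 3)),
      ((2, 0), (3, 6), (0, 1)),
      ((0, 3), (2, 3), (0, 5))]"])
    (simp_all add: signs3_def rows_in_range_def)

lemma contracted_columns_3_3: "\<exists>cs. contracted_columns (dyadic_group 3 3) 3 cs"
  by (rule contracted_columns_column3[where ts =
     "[((3, 5), (0, 4), (6, 1)),
      ((2, 0), (5, 0), (2, 4)),
      ((4, 4), (2, 2), (5, 7)),
      ((6, 5), (4, 5), (4, 0)),
      ((4, 3), (0, 3), (4, 6)),
      ((0, 4), (0, 6), (4, 4))]"])
    (simp_all add: signs3_def rows_in_range_def)

text \<open>
  For \<open>e = 1\<close> the seeds cover \<open>l = 2, 3, 4\<close>, and adding \<open>(0, 3)\<close> repeatedly covers all larger \<open>l\<close>. Subtracting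
  \<open>(2, 2)\<close> preserves \<open>e \<le> l\<close> and reduces \<open>e \<ge> 3\<close> to \<open>e - 2\<close>. Only \<open>(3, 3)\<close> would be sent to \<open>(1, 1)\<close>, which
  violates \<open>3 \<le> e + l\<close>; so \<open>(3, 3)\<close> is a seed. For \<open>e = 2\<close>, subtracting \<open>(1, 2)\<close> leads back to \<open>e = 1\<close> as soon as
  \<open>l \<ge> 4\<close>.
\<close>
lemma contracted_columns_dyadic_group:
  assumes "1 \<le> e" "e \<le> l" "3 \<le> e + l"
  shows "\<exists>cs. contracted_columns (dyadic_group e l) 3 cs"
proof -
  let ?P = "\<lambda>e l. \<exists>cs. contracted_columns (dyadic_group e l) 3 cs"
  have add: "?P (e + f) (l + m)" if "?P e l" "?P f m" for e l f m
    using that dyadic_group_extension by blast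
  have one: "?P 1 l" if "2 \<le> l" for l
    using that
  proof (induction l rule: less_induct)
    case (less l)
    have "l = 2 \<or> l = 3 \<or> l = 4 \<or> 2 \<le> l - 3 \<and> l - 3 < l \<and> l = (l - 3) + 3" using less.prems by auto
    moreover have "?P 1 l" if "2 \<le> l - 3" "l - 3 < l" "l = (l - 3) + 3"
      using add[of 1 "l - 3" 0 3] less.IH[of "l - 3"] that contracted_columns_0_3 by simp
    ultimately show ?case
      using contracted_columns_1_2 contracted_columns_1_3 contracted_columns_1_4 by blast
  qed
  show ?thesis
    using assms
  proof (induction e arbitrary: l rule: less_induct)
    case (less e)
    consider "e = 1" | "e = 2" "l = 2" | "e = 2" "l = 3" | "e = 2" "4 \<le> l" | "e = 3" "l = 3"
      | "e = 3" "4 \<le> l" | "4 \<le> e"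
      using less.prems by linarith
    then show ?case
    proof cases
      case 1
      then show ?thesis using less.prems one by simp
    next
      case 2
      then show ?thesis using contracted_columns_2_2 by simp
    next
      case 3
      then show ?thesis using contracted_columns_2_3 by simp
    next
      case 4
      have "?P (1 + 1) (2 + (l - 2))"
        using contracted_columns_1_2 one[of "l - 2"] 4 by (intro add) auto
      moreover have "1 + 1 = e" "2 + (l - 2) = l" using 4 by auto
      ultimately show ?thesis by (simp only:)
    next
      case 5
      then show ?thesis using contracted_columns_3_3 by simp
    next
      case 6
      have "?P (2 + 1) (2 + (l - 2))"
        using contracted_columns_2_2 one[of "l - 2"] 6 by (intro add) auto
      moreover have "2 + 1 = e" "2 + (l - 2) = l" using 6 by auto
      ultimately show ?thesis by (simp only:)
    next
      case 7
      then have "?P (e - 2) (l - 2)" using less.prems by (intro less.IH) auto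
      then have "?P (2 + (e - 2)) (2 + (l - 2))"
        using contracted_columns_2_2 by (intro add)
      moreover have "2 + (e - 2) = e" "2 + (l - 2) = l" using 7 less.prems by auto
      ultimately show ?thesis by (simp only:)
    qed
  qed
qed

text \<open>The group is carried over to the natural numbers by an injection of its carrier.\<close>
theorem theorem6p2:
  fixes n e :: nat
  assumes "n \<ge> 3" and "e \<ge> 1" and "real e \<le> real n / 2"
  shows "\<exists>G :: nat monoid. comm_group G \<and> order G = 2 ^ n \<and> group_exponent G = 2 ^ e \<and>
           (\<exists>M. contracted_difference_matrix 2 G 3 0 M)"
proof -
  let ?D = "dyadic_group e (n - e)"
  let ?G = "image_group (to_nat :: int \<times> int \<Rightarrow> nat) ?D"
  have n: "2 * e \<le> n" using assms(3) by linarith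
  have "inj_on (to_nat :: int \<times> int \<Rightarrow> nat) (carrier ?D)"
    by (rule inj_on_subset[OF inj_to_nat]) simp
  note iso = iso_image_group[OF comm_group_dyadic_group this]
  obtain cs where "contracted_columns ?D 3 cs"
    using contracted_columns_dyadic_group[of e "n - e"] n assms(1,2) by fastforce
  from contracted_columns_iso[OF this iso(2,1)] obtain ds where ds: "contracted_columns ?G 3 ds"
    by blast
  have ord: "order ?G = 2 ^ n"
    using iso_same_order[OF iso(1)] n by (simp add: order_dyadic_group)
  moreover have "ds \<noteq> []" using ds ord assms(1) by (auto simp: contracted_columns_def)
  moreover have "group_exponent ?G = 2 ^ e"
    using group_exponent_iso[OF comm_group.axioms(2)[OF comm_group_dyadic_group]
      comm_group.axioms(2)[OF iso(2)] iso(1)] group_exponent_dyadic_group[OF assms(2)] by simp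
  ultimately show ?thesis
    using iso(2) contracted_columns_imp_contracted_difference_matrix[OF ds] by blast
qed

end
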